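(* (a) Let $\theta : \mathbb{Z} \to Aut(\mathbb{Q})$ be a homomorphism, where $\theta(1)$ is identified with a nonzero rational number. Then $Spec(\mathbb{Q} \rtimes_\theta \mathbb{Z}) = \{\infty\}$ if $\theta(1) \neq \pm 1$, and $Spec(\mathbb{Q} \rtimes_\theta \mathbb{Z}) = \{2\} \cup \{\infty\}$ otherwise. (b) Let $p$ be an odd prime and let $\theta : \mathbb{Z} \to Aut(\mathbb{Z}[1/p])$ be a homomorphism, where $\theta(1)$ is identified with an invertible element of $\mathbb{Z}[1/p]$. If $\theta(1) \neq \pm 1$, then $Spec(\mathbb{Z}[1/p] \rtimes_\theta \mathbb{Z}) = \{\infty\}$. If $\theta(1) = 1$, then $$Spec(\mathbb{Z}[1/p] \rtimes_\theta \mathbb{Z}) = \{2(p^l + 1),\ 2(p^{l+1} - 1) \mid l \geq 0\} \cup \{\infty\}.$$ If $\theta(1) = -1$, then $$Spec(\mathbb{Z}[1/p] \rtimes_\theta \mathbb{Z}) = \{2p^{l+1} \mid l \geq 0\} \cup \{\infty\}.$$ (c) Let $\theta : \mathbb{Z} \to Aut(\mathbb{Z}[1/2])$ be a homomorphism, where $\theta(1)$ is identified with an invertible element of $\mathbb{Z}[1/2]$. If $\theta(1) \neq \pm 1$, then $Spec(\mathbb{Z}[1/2] \rtimes_\theta \mathbb{Z}) = \{\infty\}$. If $\theta(1) = 1$, then $$Spec(\mathbb{Z}[1/2] \rtimes_\theta \mathbb{Z}) = \{2(2^l + 1),\ 2(2^l - 1) \mid l \geq 1\} \cup \{\infty\}.$$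 If $\theta(1) = -1$, then $$Spec(\mathbb{Z}[1/2] \rtimes_\theta \mathbb{Z}) = \{2^{l+1} \mid l \geq 1\} \cup \{\infty\}.$$ Here $l$ ranges over integers.
   Context: For an automorphism $\phi$ of a group $G$, the Reidemeister (twisted conjugacy) classes of $\phi$ are the equivalence classes of the relation $x \sim g x \phi(g^{-1})$, $x, g \in G$, and the Reidemeister number $R(\phi)$ is the number of these classes (a positive integer or $\infty$). The Reidemeister spectrum is $Spec(G) = \{R(\phi) \mid \phi \in Aut(G)\} \subseteq \mathbb{N} \cup \{\infty\}$. $\mathbb{Z}[1/p]$ denotes the subring of $\mathbb{Q}$ generated by $1/p$, and also its additive group. For $A = \mathbb{Q}$ or $A = \mathbb{Z}[1/p]$, every automorphism of the additive group $A$ is multiplication by an invertible element of the ring $A$; the automorphism $\theta(1)$ is identified with this element, i.e. with its value at $1 \in A$. $A \rtimes_\theta \mathbb{Z}$ is the semidirect product in which the generator $1 \in \mathbb{Z}$ acts on $A$ by $\theta(1)$. *)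

theory Defs
  imports
    "HOL-Algebra.Bij"
    "HOL-Algebra.Elementary_Groups"
    "HOL-Algebra.Generated_Rings"
    "HOL-Algebra.Algebraic_Closure_Type"
    "HOL-Library.Extended_Nat"
begin

definition twisted_conj :: "('a, 'b) monoid_scheme \<Rightarrow> ('a \<Rightarrow> 'a) \<Rightarrow> ('a \<times> 'a) set" where
  "twisted_conj G \<phi> =
    {(x, y). x \<in> carrier G \<and> y \<in> carrier G \<and>
             (\<exists>g \<in> carrier G. y = g \<otimes>\<^bsub>G\<^esub> x \<otimes>\<^bsub>G\<^esub> \<phi> (inv\<^bsub>G\<^esub> g))}"

definition reidemeister_number :: "('a, 'b) monoid_scheme \<Rightarrow> ('a \<Rightarrow> 'a) \<Rightarrow> enat" where
  "reidemeister_number G \<phi> =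
    (let C = carrier G // twisted_conj G \<phi> in if finite C then enat (card C) else \<infinity>)"

definition reidemeister_spectrum :: "('a, 'b) monoid_scheme \<Rightarrow> enat set" where
  "reidemeister_spectrum G = {reidemeister_number G \<phi> | \<phi>. \<phi> \<in> auto G}"

definition semidirect_product ::
  "('a, 'c) monoid_scheme \<Rightarrow> ('b \<Rightarrow> 'a \<Rightarrow> 'a) \<Rightarrow> ('b, 'd) monoid_scheme \<Rightarrow> ('a \<times> 'b) monoid" where
  "semidirect_product A \<theta> H =
    \<lparr>carrier = carrier A \<times> carrier H,
     monoid.mult = \<lambda>(a, h) (b, k). (a \<otimes>\<^bsub>A\<^esub> \<theta> h b, h \<otimes>\<^bsub>H\<^esub> k),
     one = (\<one>\<^bsub>A\<^esub>, \<one>\<^bsub>H\<^esub>)\<rparr>"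

definition rat_group :: "rat monoid" where
  "rat_group = add_monoid (ring_of_type_algebra :: rat ring)"

definition Z_inv_ring :: "nat \<Rightarrow> rat ring" where
  "Z_inv_ring p =
    (ring_of_type_algebra :: rat ring)
      \<lparr>carrier := generate_ring ring_of_type_algebra {1 / of_nat p}\<rparr>"

definition Z_inv_group :: "nat \<Rightarrow> rat monoid" where
  "Z_inv_group p = add_monoid (Z_inv_ring p)"

lemma (in group) equiv_twisted_conj:
  assumes "\<phi> \<in> auto G"
  shows "equiv (carrier G) (twisted_conj G \<phi>)"
proof -
  interpret \<phi>: group_hom G G \<phi>
    using assms by unfold_locales (auto simp: auto_def)
  show ?thesis
  proof (rule equivI)
    show "twisted_conj G \<phi> \<subseteq> carrier G \<times> carrier G"
      by (auto simp: twisted_conj_def)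
    show "refl_on (carrier G) (twisted_conj G \<phi>)"
      by (rule refl_onI) (auto simp: twisted_conj_def intro!: bexI[of _ \<one>])
    show "sym (twisted_conj G \<phi>)"
    proof (rule symI, clarsimp simp: twisted_conj_def)
      fix x g assume x: "x \<in> carrier G" and g: "g \<in> carrier G"
      show "\<exists>h\<in>carrier G. x = h \<otimes> (g \<otimes> x \<otimes> inv \<phi> g) \<otimes> inv \<phi> h"
      proof (rule bexI[of _ "inv g"])
        have "inv g \<otimes> (g \<otimes> x) = x"
          using x g m_assoc[of "inv g" g x] by simp
        then show "x = inv g \<otimes> (g \<otimes> x \<otimes> inv \<phi> g) \<otimes> inv \<phi> (inv g)"
          using x g by (simp add: m_assoc)
      qed (use g in simp)
    qed
    show "trans (twisted_conj G \<phi>)"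
    proof (rule transI, clarsimp simp: twisted_conj_def)
      fix x g h assume "x \<in> carrier G" "g \<in> carrier G" "h \<in> carrier G"
      then show "\<exists>k\<in>carrier G. h \<otimes> (g \<otimes> x \<otimes> inv \<phi> g) \<otimes> inv \<phi> h = k \<otimes> x \<otimes> inv \<phi> k"
        by (intro bexI[of _ "h \<otimes> g"]) (simp_all add: m_assoc inv_mult_group)
    qed
  qed
qed

lemma group_semidirect_product:
  assumes "group A" "group H" "\<theta> \<in> hom H (AutoGroup A)"
  shows "group (semidirect_product A \<theta> H)"
proof -
  interpret A: group A by fact
  interpret H: group H by fact
  interpret Aut: group "AutoGroup A" by (rule A.AutoGroup)
  interpret th: group_hom H "AutoGroup A" \<theta>
    using assms(3) by unfold_locales
  have aut: "\<theta> h \<in> auto A" if "h \<in> carrier H" for h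
    using th.hom_closed[OF that] by (simp add: AutoGroup_def)
  have cl: "\<theta> h a \<in> carrier A" if "h \<in> carrier H" "a \<in> carrier A" for h a
    using aut[OF that(1)] that(2) by (auto simp: auto_def hom_def)
  have hm: "\<theta> h (a \<otimes>\<^bsub>A\<^esub> b) = \<theta> h a \<otimes>\<^bsub>A\<^esub> \<theta> h b"
    if "h \<in> carrier H" "a \<in> carrier A" "b \<in> carrier A" for h a b
    using aut[OF that(1)] that(2,3) by (auto simp: auto_def hom_def)
  have th1: "\<theta> \<one>\<^bsub>H\<^esub> a = a" if "a \<in> carrier A" for a
    using th.hom_one that by (simp add: AutoGroup_def BijGroup_def)
  have th_mult: "\<theta> (h \<otimes>\<^bsub>H\<^esub> k) a = \<theta> h (\<theta> k a)"
    if "h \<in> carrier H" "k \<in> carrier H" "a \<in> carrier A" for h k a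
    using th.hom_mult[OF that(1,2)] that(3) aut[OF that(1)] aut[OF that(2)]
    by (simp add: AutoGroup_def BijGroup_def auto_def compose_def)
  show ?thesis
  proof (rule groupI)
    fix x assume "x \<in> carrier (semidirect_product A \<theta> H)"
    then obtain a h where x: "x = (a, h)" "a \<in> carrier A" "h \<in> carrier H"
      by (auto simp: semidirect_product_def)
    show "\<exists>y\<in>carrier (semidirect_product A \<theta> H).
            y \<otimes>\<^bsub>semidirect_product A \<theta> H\<^esub> x = \<one>\<^bsub>semidirect_product A \<theta> H\<^esub>"
      by (rule bexI[of _ "(inv\<^bsub>A\<^esub> (\<theta> (inv\<^bsub>H\<^esub> h) a), inv\<^bsub>H\<^esub> h)"])
         (use x cl[of "inv\<^bsub>H\<^esub> h" a] in \<open>auto simp: semidirect_product_def simp del: th.hom_inv\<close>)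
  qed (auto simp: semidirect_product_def cl hm th1 th_mult A.m_assoc H.m_assoc simp del: th.hom_mult th.hom_one)
qed

lemma group_rat_group: "group rat_group"
proof -
  interpret ring "ring_of_type_algebra :: rat ring" by (rule ring_from_type_algebra)
  show ?thesis unfolding rat_group_def by (rule add.group_axioms)
qed

lemma group_Z_inv_group: "group (Z_inv_group p)"
proof -
  interpret R: ring "ring_of_type_algebra :: rat ring" by (rule ring_from_type_algebra)
  interpret ring "Z_inv_ring p"
    unfolding Z_inv_ring_def
    by (rule R.generate_ring_is_ring) (simp add: ring_of_type_algebra_def)
  show ?thesis unfolding Z_inv_group_def by (rule add.group_axioms)
qed

end

theory Submission
  imports Defs "HOL-Computational_Algebra.Primes"
begin

text \<open>Let \<open>A\<close> be a subring of the rationals whose additive group is \<open>q\<close>-divisible for some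
  \<open>q \<ge> 2\<close>, and let \<open>1\<close> act on \<open>A\<close> as multiplication by \<open>u\<close>. There are no nonzero homomorphisms
  from \<open>A\<close> to the integers, so every automorphism of the semidirect product has the form
  \<open>(a, m) \<mapsto> (c a + f m, \<epsilon> m)\<close> with \<open>c\<close> a unit of \<open>A\<close> and \<open>\<epsilon> = \<plusminus>1\<close>. If \<open>\<epsilon> = 1\<close>, the integer component
  is a twisted conjugacy invariant and the Reidemeister number is infinite. The case \<open>\<epsilon> = -1\<close>
  forces \<open>u\<^sup>2 = 1\<close>, and then the twisted classes over an even or odd integer component are
  counted by \<open>[A : (1 - c) A]\<close> and \<open>[A : (1 - u c) A]\<close>. Over the rationals these indices are \<open>1\<close> or
  infinite; in \<open>\<int>[1/p]\<close> the units are \<open>\<plusminus>p\<^sup>k\<close>, and an integer prime to \<open>p\<close> has its absolute value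
  as index.\<close>

section \<open>Twisted conjugacy and the counting of classes\<close>

text \<open>Moving \<open>\<phi> (inv g)\<close> to the other side removes the inverse; in a
  semidirect product only multiplication then has to be computed.\<close>

lemma (in group) twisted_conj_iff:
  assumes "\<phi> \<in> auto G"
  shows "(x, y) \<in> twisted_conj G \<phi> \<longleftrightarrow>
    x \<in> carrier G \<and> y \<in> carrier G \<and> (\<exists>g\<in>carrier G. y \<otimes> \<phi> g = g \<otimes> x)"
proof -
  interpret \<phi>: group_hom G G \<phi>
    using assms by unfold_locales (auto simp: auto_def)
  have "y = g \<otimes> x \<otimes> \<phi> (inv g) \<longleftrightarrow> y \<otimes> \<phi> g = g \<otimes> x"
    if "x \<in> carrier G" "y \<in> carrier G" "g \<in> carrier G" for g
    using that inv_solve_right[of y "g \<otimes> x" "\<phi> g"] by auto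
  then show ?thesis
    unfolding twisted_conj_def by auto
qed

text \<open>Follows the convention of \<open>reidemeister_number\<close>, so that possibly infinite
  counts can be added without case splits.\<close>

definition ecard :: "'a set \<Rightarrow> enat" where
  "ecard S = (if finite S then enat (card S) else \<infinity>)"

lemma ecard_Un_disjoint: "S \<inter> T = {} \<Longrightarrow> ecard (S \<union> T) = ecard S + ecard T"
  by (auto simp: ecard_def card_Un_disjoint)

text \<open>Both images are the quotient of \<open>S\<close> by the same relation, so sending
  \<open>F a\<close> to \<open>G a\<close> is a well-defined bijection. This is how twisted classes
  are later counted by cosets of an ideal.\<close>

lemma ecard_image_cong:
  assumes "\<And>a b. a \<in> S \<Longrightarrow> b \<in> S \<Longrightarrow> F a = F b \<longleftrightarrow> G a = G b"
  shows "ecard (F ` S) = ecard (G ` S)"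
proof -
  define h where "h y = G (SOME a. a \<in> S \<and> F a = y)" for y
  have h: "h (F a) = G a" if "a \<in> S" for a
  proof -
    have "(SOME b. b \<in> S \<and> F b = F a) \<in> S \<and> F (SOME b. b \<in> S \<and> F b = F a) = F a"
      by (rule someI[of _ a]) (use that in auto)
    then show ?thesis
      using assms that unfolding h_def by blast
  qed
  have "bij_betw h (F ` S) (G ` S)"
    unfolding bij_betw_def by (auto simp: inj_on_def h assms image_iff)
  then show ?thesis
    using bij_betw_same_card bij_betw_finite unfolding ecard_def by metis
qed

lemma reidemeister_number_ecard:
  "reidemeister_number G \<phi> = ecard ((\<lambda>x. twisted_conj G \<phi> `` {x}) ` carrier G)"
proof -
  have "carrier G // twisted_conj G \<phi> = (\<lambda>x. twisted_conj G \<phi> `` {x}) ` carrier G"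
    by (auto simp: quotient_def)
  then show ?thesis
    by (simp add: reidemeister_number_def ecard_def Let_def)
qed

text \<open>Splits off the exponent \<open>0\<close>, where the index formulas below are
  exceptional.\<close>

lemma range_nat_eq: "range f = insert (f 0) (range (\<lambda>n. f (Suc n)))"
  by (subst UNIV_nat_eq) (simp add: image_image)

lemma range_Suc_eq: "range (\<lambda>n. f (Suc n)) = {f l | l. l \<ge> 1}"
proof -
  have "f l \<in> range (\<lambda>n. f (Suc n))" if "l \<ge> 1" for l
    by (rule range_eqI[of _ _ "l - 1"]) (use that in simp)
  then show ?thesis
    by auto
qed

text \<open>Bridges the two ways of indexing the families: by \<open>l + 1\<close> for odd primes,
  by \<open>l \<ge> 1\<close> in the range computations.\<close>

lemma shift_index: "{f (l + 1) | l :: nat. l \<ge> 0} = {f l | l. l \<ge> 1}"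
  unfolding range_Suc_eq[symmetric] by auto

section \<open>Subrings of the rationals\<close>

locale rat_subring =
  fixes A :: "rat set"
  assumes one_mem: "1 \<in> A"
    and add_mem: "a \<in> A \<Longrightarrow> b \<in> A \<Longrightarrow> a + b \<in> A"
    and uminus_mem: "a \<in> A \<Longrightarrow> - a \<in> A"
    and mult_mem: "a \<in> A \<Longrightarrow> b \<in> A \<Longrightarrow> a * b \<in> A"
begin

abbreviation "M \<equiv> \<lparr>carrier = A, monoid.mult = (+), one = (0 :: rat)\<rparr>"

lemma diff_mem: "a \<in> A \<Longrightarrow> b \<in> A \<Longrightarrow> a - b \<in> A"
  using add_mem[of a "- b"] uminus_mem by simp

lemma zero_mem: "0 \<in> A"
  using diff_mem[OF one_mem one_mem] by simp

lemma of_nat_mem: "of_nat n \<in> A"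
  by (induction n) (auto simp: zero_mem one_mem add_mem)

lemma of_int_mem: "of_int k \<in> A"
  by (cases k rule: int_cases2) (auto simp: of_nat_mem uminus_mem)

lemma power_mem: "a \<in> A \<Longrightarrow> a ^ n \<in> A"
  by (induction n) (auto simp: one_mem mult_mem)

text \<open>An additive map commutes with integer multiples. For \<open>x = k / l\<close>,
  multiplying by \<open>l\<close> reduces the claim to integer multiples of
  \<open>1\<close>.\<close>

lemma additive_eq:
  fixes f :: "rat \<Rightarrow> rat"
  assumes add: "\<And>a b. a \<in> A \<Longrightarrow> b \<in> A \<Longrightarrow> f (a + b) = f a + f b" and x: "x \<in> A"
  shows "f x = x * f 1"
proof -
  have f0: "f 0 = 0"
    using add[OF zero_mem zero_mem] by simp
  have fneg: "f (- a) = - f a" if "a \<in> A" for a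
    using add[OF that uminus_mem[OF that]] f0 by simp
  have fnat: "f (of_nat n * a) = of_nat n * f a" if "a \<in> A" for n a
    by (induction n) (auto simp: f0 add that mult_mem of_nat_mem distrib_right)
  have fint: "f (of_int k * a) = of_int k * f a" if "a \<in> A" for k a
    using fnat[OF that] fneg[OF mult_mem[OF of_nat_mem that]]
    by (cases k rule: int_cases2) auto
  obtain k l where kl: "x = of_int k / of_int l" "l > 0"
    by (metis quotient_of_div quotient_of_denom_pos surj_pair)
  have "of_int l * f x = f (of_int l * x)"
    using fint[OF x] by simp
  also have "of_int l * x = of_int k * 1"
    using kl by simp
  also have "f (of_int k * 1) = of_int k * f 1"
    by (rule fint[OF one_mem])
  finally show ?thesis
    using kl(2) unfolding kl(1) by (simp add: field_simps)
qed

lemma group_M: "group M"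
  by (rule groupI) (auto simp: zero_mem add_mem intro!: bexI[of _ "- _"] uminus_mem)

section \<open>Indices of principal ideals\<close>

definition ideal_coset :: "rat \<Rightarrow> rat \<Rightarrow> rat set" where
  "ideal_coset x a = {b \<in> A. \<exists>t\<in>A. b - a = x * t}"

definition ideal_index :: "rat \<Rightarrow> enat" where
  "ideal_index x = ecard (ideal_coset x ` A)"

definition invertible :: "rat \<Rightarrow> bool" where
  "invertible c \<longleftrightarrow> c \<in> A \<and> (\<exists>d\<in>A. c * d = 1)"

lemma ideal_coset_eq_iff:
  assumes "a \<in> A" "b \<in> A"
  shows "ideal_coset x a = ideal_coset x b \<longleftrightarrow> (\<exists>t\<in>A. b - a = x * t)"
proof
  assume "ideal_coset x a = ideal_coset x b"
  moreover have "b \<in> ideal_coset x b"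
    using assms zero_mem by (auto simp: ideal_coset_def intro!: bexI[of _ 0])
  ultimately have "b \<in> ideal_coset x a"
    by simp
  then show "\<exists>t\<in>A. b - a = x * t"
    by (simp add: ideal_coset_def)
next
  assume "\<exists>t\<in>A. b - a = x * t"
  then obtain t where t: "t \<in> A" "b - a = x * t" by blast
  show "ideal_coset x a = ideal_coset x b"
  proof (rule Set.set_eqI)
    fix y
    have "\<exists>s\<in>A. y - b = x * s" if "s \<in> A" "y - a = x * s" for s
      using that t diff_mem by (intro bexI[of _ "s - t"]) (auto simp: algebra_simps)
    moreover have "\<exists>s\<in>A. y - a = x * s" if "s \<in> A" "y - b = x * s" for s
      using that t add_mem by (intro bexI[of _ "s + t"]) (auto simp: algebra_simps)
    ultimately show "y \<in> ideal_coset x a \<longleftrightarrow> y \<in> ideal_coset x b"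
      unfolding ideal_coset_def by blast
  qed
qed

text \<open>A unit \<open>c\<close> satisfies \<open>c A = A\<close>, so \<open>c * x\<close> and
  \<open>x\<close> have the same multiples in \<open>A\<close> and hence the same cosets.\<close>

lemma ideal_index_mult_invertible:
  assumes "invertible c"
  shows "ideal_index (c * x) = ideal_index x"
proof -
  obtain d where d: "d \<in> A" "c * d = 1" and c: "c \<in> A"
    using assms by (auto simp: invertible_def)
  have "(\<exists>t\<in>A. z = c * x * t) \<longleftrightarrow> (\<exists>t\<in>A. z = x * t)" for z
  proof
    assume "\<exists>t\<in>A. z = c * x * t"
    then obtain t where "t \<in> A" "z = x * (c * t)"
      by (auto simp: mult_ac)
    then show "\<exists>t\<in>A. z = x * t"
      using c mult_mem by blast
  next
    assume "\<exists>t\<in>A. z = x * t"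
    then obtain t where t: "t \<in> A" "z = x * t" by blast
    have "x * t = (c * d) * (x * t)"
      using d by simp
    then have "z = c * x * (d * t)"
      using t by (simp add: mult_ac)
    then show "\<exists>t\<in>A. z = c * x * t"
      using d t mult_mem by blast
  qed
  then show ?thesis
    by (simp add: ideal_index_def ideal_coset_def)
qed

lemma infinite_carrier: "infinite A"
proof
  assume "finite A"
  moreover have "range rat_of_nat \<subseteq> A"
    using of_nat_mem by auto
  ultimately have "finite (range rat_of_nat)"
    by (rule rev_finite_subset)
  then show False
    using finite_imageD[of rat_of_nat UNIV] by (simp add: inj_on_def)
qed

text \<open>Cosets of the zero ideal are singletons, and \<open>A\<close> is infinite since it
  contains the natural numbers.\<close>

lemma ideal_index_0: "ideal_index 0 = \<infinity>"
proof -
  have "inj_on (ideal_coset 0) A"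
    by (rule inj_onI) (auto simp: ideal_coset_eq_iff)
  then show ?thesis
    using infinite_carrier by (auto simp: ideal_index_def ecard_def dest: finite_imageD)
qed

lemma ideal_index_1: "ideal_index 1 = 1"
proof -
  have "ideal_coset 1 a = A" if "a \<in> A" for a
    using that diff_mem by (auto simp: ideal_coset_def)
  then have "ideal_coset 1 ` A = {A}"
    using one_mem by auto
  then show ?thesis
    by (simp add: ideal_index_def ecard_def one_enat_def)
qed

lemma ideal_index_invertible: "invertible c \<Longrightarrow> ideal_index c = 1"
  using ideal_index_mult_invertible[of c 1] ideal_index_1 by simp

end

section \<open>Semidirect products with the integers\<close>

locale rat_semidirect = rat_subring +
  fixes q :: nat and \<theta> :: "int \<Rightarrow> rat \<Rightarrow> rat"
  assumes q_ge_2: "q \<ge> 2" and inverse_q_mem: "1 / of_nat q \<in> A"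
    and theta_hom: "\<theta> \<in> hom integer_group (AutoGroup M)"
begin

section \<open>The action and the group law\<close>

abbreviation "G \<equiv> semidirect_product M \<theta> integer_group"
abbreviation "u \<equiv> \<theta> 1 1"

text \<open>By \<open>additive_eq\<close> the value at \<open>1 / q ^ k\<close> is
  \<open>h 1 / q ^ k\<close>, so every power of \<open>q\<close> divides the integer
  \<open>h 1\<close>. A power larger than its absolute value forces \<open>h 1 = 0\<close>.\<close>

lemma additive_int_eq_0:
  fixes h :: "rat \<Rightarrow> int"
  assumes add: "\<And>a b. a \<in> A \<Longrightarrow> b \<in> A \<Longrightarrow> h (a + b) = h a + h b" and x: "x \<in> A"
  shows "h x = 0"
proof -
  have h: "of_int (h y) = y * of_int (h 1)" if "y \<in> A" for y
    by (rule additive_eq[OF _ that]) (simp add: add)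
  \<comment> \<open>Any exponent with \<open>q ^ k > \<bar>h 1\<bar>\<close> would do; this one
    qualifies because \<open>k < 2 ^ k\<close>.\<close>
  define k where "k = nat \<bar>h 1\<bar>"
  have "(1 / of_nat q) ^ k \<in> A"
    using inverse_q_mem by (rule power_mem)
  from h[OF this] have "of_int (h 1) = rat_of_int (of_nat q ^ k * h ((1 / of_nat q) ^ k))"
    using q_ge_2 by (simp add: power_divide)
  then have "h 1 = of_nat q ^ k * h ((1 / of_nat q) ^ k)"
    by (simp only: of_int_eq_iff)
  then have "int q ^ k dvd h 1"
    by (rule dvdI)
  moreover have "\<bar>h 1\<bar> < int q ^ k"
  proof -
    have "k < 2 ^ k" by simp
    also have "\<dots> \<le> q ^ k" using q_ge_2 by (rule power_mono) simp
    finally have "int k < int (q ^ k)" by (simp only: of_nat_less_iff)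
    then show ?thesis by (simp add: k_def)
  qed
  ultimately have "h 1 = 0"
    using dvd_imp_le_int[of "h 1" "int q ^ k"] by force
  then show ?thesis
    using h[OF x] by simp
qed

lemma theta_auto: "\<theta> m \<in> auto M"
  using hom_in_carrier[OF theta_hom, of m] by (simp add: AutoGroup_def)

lemma theta_mem: "a \<in> A \<Longrightarrow> \<theta> m a \<in> A"
  using theta_auto[of m] by (auto simp: auto_def hom_def)

lemma theta_eq: "a \<in> A \<Longrightarrow> \<theta> m a = \<theta> m 1 * a"
  using additive_eq[of "\<theta> m" a] theta_auto[of m] by (auto simp: auto_def hom_def mult.commute)

lemma theta_add: "\<theta> (m + n) 1 = \<theta> m 1 * \<theta> n 1"
proof -
  have "\<theta> (m + n) 1 = \<theta> m (\<theta> n 1)"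
    using hom_mult[OF theta_hom, of m n] theta_auto[of m] theta_auto[of n] one_mem
    by (simp add: AutoGroup_def BijGroup_def auto_def compose_def)
  then show ?thesis
    using theta_eq[of "\<theta> n 1" m] theta_mem[OF one_mem] by simp
qed

text \<open>\<open>theta_add\<close> makes \<open>\<theta> 0 1\<close> idempotent, hence
  \<open>0\<close> or \<open>1\<close>; the value \<open>0\<close> would turn the automorphism
  \<open>\<theta> 0\<close> into the zero map.\<close>

lemma theta_0: "\<theta> 0 1 = 1"
proof -
  have "\<theta> 0 1 \<noteq> 0"
  proof
    assume "\<theta> 0 1 = 0"
    then have "\<theta> 0 ` A \<subseteq> {0}"
      using theta_eq[where m = 0] by (metis image_subsetI insertI1 mult_zero_left)
    moreover have "\<theta> 0 ` A = A"
      using theta_auto[of 0] by (auto simp: auto_def Bij_def bij_betw_def)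
    ultimately show False
      using one_mem by auto
  qed
  then show ?thesis
    using theta_add[of 0 0] by simp
qed

lemma theta_uminus: "\<theta> m 1 * \<theta> (- m) 1 = 1"
  using theta_add[of m "- m"] theta_0 by simp

lemma theta_ne_0: "\<theta> m 1 \<noteq> 0"
  using theta_uminus[of m] by auto

lemma theta_square:
  assumes "u * u = 1"
  shows "\<theta> m 1 * \<theta> m 1 = 1"
proof (induction m rule: int_induct[of _ 0])
  case base
  then show ?case by (simp add: theta_0)
next
  case (step1 i)
  then show ?case
    using theta_add[of i 1] assms by (simp add: algebra_simps)
next
  case (step2 i)
  have "\<theta> i 1 * \<theta> i 1 = (\<theta> (i - 1) 1 * \<theta> (i - 1) 1) * (u * u)"
    using theta_add[of "i - 1" 1] by (simp add: mult_ac)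
  then show ?case
    using step2 assms by simp
qed

text \<open>The scalar of \<open>\<theta> m\<close> is its own inverse by
  \<open>theta_square\<close>. This makes negating the integer component compatible with the
  action.\<close>

lemma theta_uminus_eq: "u * u = 1 \<Longrightarrow> \<theta> (- m) 1 = \<theta> m 1"
  using theta_square[of m] theta_uminus[of m] theta_ne_0[of m] mult_left_cancel by metis

lemma carrier_G: "carrier G = A \<times> UNIV"
  by (simp add: semidirect_product_def)

lemma mult_G: "b \<in> A \<Longrightarrow> (a, m) \<otimes>\<^bsub>G\<^esub> (b, n) = (a + \<theta> m 1 * b, m + n)"
  using theta_eq[of b m] by (simp add: semidirect_product_def)

sublocale G: group G
  by (rule group_semidirect_product[OF group_M group_integer_group theta_hom])

section \<open>The shape of the automorphisms\<close>

lemma auto_fst_mem: "\<phi> \<in> auto G \<Longrightarrow> a \<in> A \<Longrightarrow> fst (\<phi> (a, m)) \<in> A"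
  using hom_in_carrier[of \<phi> G G "(a, m)"] by (auto simp: auto_def carrier_G mem_Times_iff)

lemma auto_mult:
  assumes "\<phi> \<in> auto G" "a \<in> A" "b \<in> A"
  shows "\<phi> (a + \<theta> m 1 * b, m + n) =
    (fst (\<phi> (a, m)) + \<theta> (snd (\<phi> (a, m))) 1 * fst (\<phi> (b, n)), snd (\<phi> (a, m)) + snd (\<phi> (b, n)))"
proof -
  have "\<phi> ((a, m) \<otimes>\<^bsub>G\<^esub> (b, n)) = \<phi> (a, m) \<otimes>\<^bsub>G\<^esub> \<phi> (b, n)"
    using assms by (intro hom_mult[of _ G G]) (auto simp: auto_def carrier_G)
  then show ?thesis
    using assms mult_G[of "fst (\<phi> (b, n))" "fst (\<phi> (a, m))" "snd (\<phi> (a, m))" "snd (\<phi> (b, n))"]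
    by (simp add: mult_G auto_fst_mem)
qed

text \<open>The integer component of \<open>\<phi>\<close> is additive on \<open>A\<close>, so
  \<open>additive_int_eq_0\<close> kills it: \<open>A\<close> is a characteristic subgroup.\<close>

lemma auto_snd_fst:
  assumes "\<phi> \<in> auto G" "a \<in> A"
  shows "snd (\<phi> (a, 0)) = 0"
  using auto_mult[OF assms(1), of _ _ 0 0]
  by (intro additive_int_eq_0[OF _ assms(2), of "\<lambda>a. snd (\<phi> (a, 0))"]) (simp add: theta_0)

text \<open>Of the translation part \<open>f\<close> it records just what the counting of classes
  uses: values in \<open>A\<close> and \<open>f 0 = 0\<close>.\<close>

definition affine_form :: "(rat \<times> int \<Rightarrow> rat \<times> int) \<Rightarrow> rat \<Rightarrow> (int \<Rightarrow> rat) \<Rightarrow> int \<Rightarrow> bool" where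
  "affine_form \<phi> c f \<epsilon> \<longleftrightarrow>
    c \<in> A \<and> f 0 = 0 \<and> range f \<subseteq> A \<and> (\<forall>a\<in>A. \<forall>m. \<phi> (a, m) = (c * a + f m, \<epsilon> * m))"

lemma affine_formD:
  assumes "affine_form \<phi> c f \<epsilon>"
  shows "c \<in> A" "f 0 = 0" "f m \<in> A" "a \<in> A \<Longrightarrow> \<phi> (a, m) = (c * a + f m, \<epsilon> * m)"
  using assms by (auto simp: affine_form_def)

text \<open>Factor \<open>(a, m)\<close> as \<open>(a, 0) (0, m)\<close>. The first factor stays in
  \<open>A\<close> and is scaled, by \<open>additive_eq\<close>; the integer component of the image
  of the second is additive in \<open>m\<close>.\<close>

lemma auto_affine_form:
  assumes "\<phi> \<in> auto G"
  shows "affine_form \<phi> (fst (\<phi> (1, 0))) (\<lambda>m. fst (\<phi> (0, m))) (snd (\<phi> (0, 1)))"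
proof -
  have eps: "snd (\<phi> (0, m)) = snd (\<phi> (0, 1)) * m" for m
  proof -
    have add: "snd (\<phi> (0, m + n)) = snd (\<phi> (0, m)) + snd (\<phi> (0, n))" for m n
      using auto_mult[OF assms(1) zero_mem zero_mem, of m n] by simp
    have zero: "snd (\<phi> (0, 0)) = 0"
      using add[of 0 0] by simp
    show ?thesis
    proof (induction m rule: int_induct[of _ 0])
      case base
      then show ?case by (simp add: zero)
    next
      case (step1 i)
      then show ?case using add[of i 1] by (simp add: algebra_simps)
    next
      case (step2 i)
      then show ?case using add[of "i - 1" 1] by (simp add: algebra_simps)
    qed
  qed
  have c: "fst (\<phi> (a, 0)) = a * fst (\<phi> (1, 0))" if "a \<in> A" for a
    using auto_mult[OF assms(1), of _ _ 0 0] auto_snd_fst[OF assms(1)]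
    by (intro additive_eq[OF _ that, of "\<lambda>a. fst (\<phi> (a, 0))"]) (simp add: theta_0)
  have "\<phi> (a, m) = (fst (\<phi> (1, 0)) * a + fst (\<phi> (0, m)), snd (\<phi> (0, 1)) * m)" if "a \<in> A" for a m
  proof -
    have "\<phi> (a, m) = (fst (\<phi> (a, 0)) + fst (\<phi> (0, m)), snd (\<phi> (0, m)))"
      using auto_mult[OF assms that zero_mem, of 0 m] auto_snd_fst[OF assms that]
      by (simp add: theta_0)
    then show ?thesis
      unfolding c[OF that] eps[of m] by (simp only: mult.commute)
  qed
  moreover have "fst (\<phi> (0, 0)) = 0"
    using c[OF zero_mem] by simp
  moreover have "range (\<lambda>m. fst (\<phi> (0, m))) \<subseteq> A"
    using auto_fst_mem[OF assms zero_mem] by blast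
  ultimately show ?thesis
    unfolding affine_form_def using auto_fst_mem[OF assms one_mem] by blast
qed

text \<open>Both claims come from surjectivity: a preimage of \<open>(0, 1)\<close> inverts
  \<open>\<epsilon>\<close> in the integers, and a preimage of \<open>(1, 0)\<close> lies over
  \<open>0\<close> and inverts \<open>c\<close>.\<close>

lemma affine_form_invertible:
  assumes "\<phi> \<in> auto G" "affine_form \<phi> c f \<epsilon>"
  shows "invertible c" and "\<epsilon> = 1 \<or> \<epsilon> = -1"
proof -
  note \<phi> = affine_formD[OF assms(2)]
  have surj: "\<exists>a\<in>A. \<exists>m. \<phi> (a, m) = (b, n)" if "b \<in> A" for b n
  proof -
    have "(b, n) \<in> \<phi> ` (A \<times> UNIV)"
      using assms(1) that carrier_G by (auto simp: auto_def Bij_def bij_betw_def)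
    then obtain x where "x \<in> A \<times> UNIV" "\<phi> x = (b, n)"
      by (metis imageE)
    then show ?thesis by (cases x) auto
  qed
  obtain a m where "a \<in> A" "\<phi> (a, m) = (0, 1)"
    using surj[OF zero_mem] by blast
  then have eps: "\<epsilon> * m = 1"
    using \<phi>(4) by simp
  then show "\<epsilon> = 1 \<or> \<epsilon> = -1"
    using zmult_eq_1_iff by blast
  obtain b n where b: "b \<in> A" "\<phi> (b, n) = (1, 0)"
    using surj[OF one_mem] by blast
  then have "n = 0"
    using \<phi>(4) eps by auto
  then have "c * b = 1"
    using \<phi>(2) \<phi>(4)[OF b(1), of n] b(2) by simp
  then show "invertible c"
    using b(1) \<phi>(1) by (auto simp: invertible_def)
qed

text \<open>Compare the images of the two sides of \<open>(0, 1) (1, 0) = (u, 0) (0, 1)\<close>.\<close>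
lemma affine_form_inverting_imp:
  assumes "\<phi> \<in> auto G" "affine_form \<phi> c f (-1)"
  shows "u * u = 1"
proof -
  note \<phi> = affine_formD[OF assms(2)]
  have "\<phi> (u, 1) = (f 1 + \<theta> (-1) 1 * c, -1)"
    using auto_mult[OF assms(1) zero_mem one_mem, of 1 0] \<phi>(2) \<phi>(4)[OF zero_mem] \<phi>(4)[OF one_mem]
    by simp
  moreover have "\<phi> (u, 1) = (c * u + f 1, -1)"
    using \<phi>(4)[OF theta_mem[OF one_mem], of 1 1] by simp
  moreover have "c \<noteq> 0"
    using affine_form_invertible(1)[OF assms] by (auto simp: invertible_def)
  ultimately have "\<theta> (-1) 1 = u"
    by simp
  then show ?thesis
    using theta_uminus[of 1] by simp
qed

section \<open>Counting twisted conjugacy classes\<close>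

lemma twisted_conj_G_iff:
  assumes "\<phi> \<in> auto G" "affine_form \<phi> c f \<epsilon>" "a \<in> A" "b \<in> A"
  shows "((a, m), (b, n)) \<in> twisted_conj G \<phi> \<longleftrightarrow>
    (\<exists>g\<in>A. \<exists>k. b + \<theta> n 1 * (c * g + f k) = g + \<theta> k 1 * a \<and> n + \<epsilon> * k = k + m)"
proof -
  note \<phi> = affine_formD[OF assms(2)]
  have "(b, n) \<otimes>\<^bsub>G\<^esub> \<phi> (g, k) = (g, k) \<otimes>\<^bsub>G\<^esub> (a, m) \<longleftrightarrow>
    b + \<theta> n 1 * (c * g + f k) = g + \<theta> k 1 * a \<and> n + \<epsilon> * k = k + m"
    if "g \<in> A" for g k
    using that by (simp add: \<phi> assms mult_G add_mem mult_mem)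
  then show ?thesis
    using assms(3,4) unfolding G.twisted_conj_iff[OF assms(1)] by (auto simp: carrier_G)
qed

lemma twisted_class_eq_iff:
  assumes "\<phi> \<in> auto G" "x \<in> carrier G" "y \<in> carrier G"
  shows "twisted_conj G \<phi> `` {x} = twisted_conj G \<phi> `` {y} \<longleftrightarrow> (x, y) \<in> twisted_conj G \<phi>"
  using eq_equiv_class_iff[OF G.equiv_twisted_conj[OF assms(1)] assms(2,3)] .

text \<open>For \<open>\<epsilon> = 1\<close> the integer equation in
  \<open>twisted_conj_G_iff\<close> cancels to \<open>n = m\<close>, so the elements
  \<open>(0, m)\<close> lie in pairwise distinct classes.\<close>

lemma reidemeister_number_preserving:
  assumes "\<phi> \<in> auto G" "affine_form \<phi> c f 1"
  shows "reidemeister_number G \<phi> = \<infinity>"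
proof -
  let ?F = "\<lambda>x. twisted_conj G \<phi> `` {x}"
  have "inj (\<lambda>m. ?F (0, m))"
  proof (rule injI)
    fix m n :: int
    assume "?F (0, m) = ?F (0, n)"
    then have "((0, m), (0, n)) \<in> twisted_conj G \<phi>"
      using twisted_class_eq_iff[OF assms(1)] zero_mem by (simp add: carrier_G)
    then show "m = n"
      using twisted_conj_G_iff[OF assms zero_mem zero_mem] by auto
  qed
  then have "infinite (range (\<lambda>m. ?F (0, m)))"
    using finite_imageD infinite_UNIV_int by blast
  moreover have "range (\<lambda>m. ?F (0, m)) \<subseteq> ?F ` carrier G"
    using zero_mem by (auto simp: carrier_G)
  ultimately have "infinite (?F ` carrier G)"
    using finite_subset by blast
  then show ?thesis
    by (simp add: reidemeister_number_ecard ecard_def)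
qed

text \<open>Twisted conjugation by \<open>(0, k)\<close> shifts the integer component by \<open>2k\<close>, so every class has
  a representative over \<open>0\<close> or \<open>1\<close>; two representatives with the same integer component can
  only be conjugated by an element of \<open>A\<close>.\<close>
lemma reidemeister_number_inverting:
  assumes "\<phi> \<in> auto G" "affine_form \<phi> c f (-1)"
  shows "reidemeister_number G \<phi> = ideal_index (1 - c) + ideal_index (1 - u * c)"
proof -
  note \<phi> = affine_formD[OF assms(2)]
  let ?F = "\<lambda>x. twisted_conj G \<phi> `` {x}"
  let ?S = "\<lambda>m. (\<lambda>a. ?F (a, m)) ` A"
  have iff: "?F (a, m) = ?F (b, n) \<longleftrightarrow>
      (\<exists>g\<in>A. \<exists>k. b + \<theta> n 1 * (c * g + f k) = g + \<theta> k 1 * a \<and> n = m + 2 * k)"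
    if "a \<in> A" "b \<in> A" for a b m n
  proof -
    have "n + - 1 * k = k + m \<longleftrightarrow> n = m + 2 * k" for k
      by linarith
    then show ?thesis
      using twisted_class_eq_iff[OF assms(1), of "(a, m)" "(b, n)"]
        twisted_conj_G_iff[OF assms that, of m n] that
      by (simp add: carrier_G)
  qed
  have card: "ecard (?S m) = ideal_index (1 - \<theta> m 1 * c)" for m
    unfolding ideal_index_def
  proof (rule ecard_image_cong)
    fix a b assume ab: "a \<in> A" "b \<in> A"
    \<comment> \<open>Equal integer components force \<open>k = 0\<close>, where \<open>f\<close>
      vanishes and \<open>\<theta>\<close> acts trivially; what remains is congruence modulo
      \<open>1 - \<theta> m 1 * c\<close>.\<close>
    have "?F (a, m) = ?F (b, m) \<longleftrightarrow> (\<exists>g\<in>A. b + \<theta> m 1 * (c * g) = g + a)"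
      unfolding iff[OF ab, of m m] by (simp add: \<phi>(2) theta_0)
    also have "\<dots> \<longleftrightarrow> (\<exists>t\<in>A. b - a = (1 - \<theta> m 1 * c) * t)"
      by (intro bex_cong) (auto simp: algebra_simps)
    finally show "?F (a, m) = ?F (b, m) \<longleftrightarrow>
        ideal_coset (1 - \<theta> m 1 * c) a = ideal_coset (1 - \<theta> m 1 * c) b"
      using ideal_coset_eq_iff[OF ab] by simp
  qed
  have "?F x \<in> ?S 0 \<union> ?S 1" if x: "x \<in> carrier G" for x
  proof -
    obtain a m where am: "x = (a, m)" "a \<in> A"
      using x carrier_G by auto
    \<comment> \<open>This \<open>k\<close> shifts \<open>m\<close> to its residue modulo
      \<open>2\<close>, and \<open>b\<close> solves the conjugation equation for
      \<open>g = 0\<close>.\<close>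
    define n k where "n = m mod 2" and "k = - (m div 2)"
    define b where "b = \<theta> k 1 * a - \<theta> n 1 * f k"
    have "b \<in> A"
      unfolding b_def using am \<phi>(3) theta_mem[OF one_mem]
      by (intro diff_mem mult_mem) auto
    have "n = m + 2 * k"
      unfolding n_def k_def using mult_div_mod_eq[of 2 m] by linarith
    moreover have "b + \<theta> n 1 * (c * 0 + f k) = 0 + \<theta> k 1 * a"
      by (simp add: b_def)
    ultimately have "?F x = ?F (b, n)"
      unfolding am(1) iff[OF am(2) \<open>b \<in> A\<close>] using zero_mem by blast
    moreover have "n = 0 \<or> n = 1"
      unfolding n_def by auto
    ultimately show ?thesis
      using \<open>b \<in> A\<close> by auto
  qed
  then have "?F ` carrier G \<subseteq> ?S 0 \<union> ?S 1"
    by blast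
  moreover have "?S 0 \<union> ?S 1 \<subseteq> ?F ` carrier G"
    unfolding carrier_G by blast
  ultimately have "?F ` carrier G = ?S 0 \<union> ?S 1"
    by (rule subset_antisym)
  moreover have "?F (a, 0) \<noteq> ?F (b, 1)" if "a \<in> A" "b \<in> A" for a b
  proof -
    have "1 \<noteq> 0 + 2 * k" for k :: int
      by presburger
    then show ?thesis
      unfolding iff[OF that] by blast
  qed
  then have "?S 0 \<inter> ?S 1 = {}"
    by blast
  ultimately show ?thesis
    using card[of 0] card[of 1]
    by (simp add: reidemeister_number_ecard ecard_Un_disjoint theta_0)
qed

section \<open>Realised values and the spectrum\<close>

text \<open>The witness is \<open>(a, m) \<mapsto> (c * a, - m)\<close>. Its multiplicativity comes
  down to \<open>\<theta> (- m) 1 = \<theta> m 1\<close>, which is where \<open>u * u = 1\<close>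
  enters.\<close>

lemma exists_inverting_auto:
  assumes "u * u = 1" and c: "invertible c"
  shows "\<exists>\<phi>\<in>auto G. affine_form \<phi> c (\<lambda>_. 0) (-1)"
proof -
  obtain d where d: "c \<in> A" "d \<in> A" "c * d = 1"
    using c by (auto simp: invertible_def)
  \<comment> \<open>The restriction to the carrier is there because members of \<open>auto G\<close>
    are extensional functions.\<close>
  define \<phi> where "\<phi> = (\<lambda>(a, m)\<in>carrier G. (c * a, - m))"
  have "\<phi> \<in> hom G G"
  proof (rule homI)
    fix x y assume "x \<in> carrier G" "y \<in> carrier G"
    then show "\<phi> (x \<otimes>\<^bsub>G\<^esub> y) = \<phi> x \<otimes>\<^bsub>G\<^esub> \<phi> y"
      using d theta_uminus_eq[OF assms(1)]
      by (auto simp: \<phi>_def carrier_G mult_G add_mem mult_mem theta_mem one_mem algebra_simps)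
  qed (use d in \<open>auto simp: \<phi>_def carrier_G mult_mem\<close>)
  moreover have "bij_betw \<phi> (carrier G) (carrier G)"
  proof (rule bij_betw_byWitness[where f' = "\<lambda>(a, m). (d * a, - m)"])
    show "\<forall>x\<in>carrier G. (\<lambda>(a, m). (d * a, - m)) (\<phi> x) = x"
      using d by (auto simp: \<phi>_def carrier_G mult.assoc[symmetric] mult.commute[of d])
    show "\<forall>x\<in>carrier G. \<phi> ((\<lambda>(a, m). (d * a, - m)) x) = x"
      using d by (auto simp: \<phi>_def carrier_G mult.assoc[symmetric] mult_mem)
  qed (use d in \<open>auto simp: \<phi>_def carrier_G mult_mem\<close>)
  ultimately have "\<phi> \<in> auto G"
    by (auto simp: auto_def Bij_def \<phi>_def)
  then show ?thesis
    by (intro bexI[of _ \<phi>]) (use d in \<open>auto simp: \<phi>_def carrier_G affine_form_def zero_mem\<close>)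
qed

lemma infinity_in_spectrum: "\<infinity> \<in> reidemeister_spectrum G"
proof -
  let ?\<phi> = "\<lambda>x\<in>carrier G. x"
  have "?\<phi> \<in> auto G"
    by (rule G.id_in_auto)
  moreover have "affine_form ?\<phi> 1 (\<lambda>_. 0) 1"
    by (auto simp: affine_form_def carrier_G zero_mem one_mem)
  ultimately have "?\<phi> \<in> auto G" "\<infinity> = reidemeister_number G ?\<phi>"
    using reidemeister_number_preserving by simp_all
  then show ?thesis
    unfolding reidemeister_spectrum_def by blast
qed

lemma spectrum_trivial:
  assumes "u * u \<noteq> 1"
  shows "reidemeister_spectrum G = {\<infinity>}"
proof -
  have "reidemeister_number G \<phi> = \<infinity>" if "\<phi> \<in> auto G" for \<phi>
    using auto_affine_form[OF that] affine_form_invertible(2)[OF that]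
      affine_form_inverting_imp[OF that] reidemeister_number_preserving[OF that] assms by metis
  then show ?thesis
    using infinity_in_spectrum by (auto simp: reidemeister_spectrum_def)
qed

text \<open>For inverting automorphisms the count depends on \<open>c\<close> alone, so those with
  translation part \<open>0\<close> already realise every value; the preserving ones contribute
  \<open>\<infinity>\<close>.\<close>

lemma spectrum_eq:
  assumes "u * u = 1"
  shows "reidemeister_spectrum G =
    {ideal_index (1 - c) + ideal_index (1 - u * c) | c. invertible c} \<union> {\<infinity>}" (is "_ = ?R \<union> _")
proof
  show "reidemeister_spectrum G \<subseteq> ?R \<union> {\<infinity>}"
  proof
    fix r assume "r \<in> reidemeister_spectrum G"
    then obtain \<phi> where \<phi>: "\<phi> \<in> auto G" "r = reidemeister_number G \<phi>"
      by (auto simp: reidemeister_spectrum_def)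
    obtain c f \<epsilon> where form: "affine_form \<phi> c f \<epsilon>"
      using auto_affine_form[OF \<phi>(1)] by blast
    show "r \<in> ?R \<union> {\<infinity>}"
      using affine_form_invertible(2)[OF \<phi>(1) form]
    proof
      assume "\<epsilon> = 1"
      then show ?thesis
        using reidemeister_number_preserving \<phi> form by simp
    next
      assume "\<epsilon> = -1"
      then have "r = ideal_index (1 - c) + ideal_index (1 - u * c)"
        using reidemeister_number_inverting \<phi> form by simp
      then show ?thesis
        using affine_form_invertible(1)[OF \<phi>(1) form] by blast
    qed
  qed
  have "r \<in> reidemeister_spectrum G" if r: "r \<in> ?R" for r
  proof -
    obtain c where c: "invertible c" "r = ideal_index (1 - c) + ideal_index (1 - u * c)"
      using r by blast
    obtain \<phi> where \<phi>: "\<phi> \<in> auto G" "affine_form \<phi> c (\<lambda>_. 0) (-1)"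
      using exists_inverting_auto[OF assms c(1)] by blast
    have "r = reidemeister_number G \<phi>"
      using reidemeister_number_inverting[OF \<phi>] c(2) by simp
    then show ?thesis
      using \<phi>(1) unfolding reidemeister_spectrum_def by blast
  qed
  then show "?R \<union> {\<infinity>} \<subseteq> reidemeister_spectrum G"
    using infinity_in_spectrum by blast
qed

end

section \<open>The rings \<open>\<rat>\<close> and \<open>\<int>[1/p]\<close>\<close>

lemma rat_group_eq: "rat_group = \<lparr>carrier = UNIV, monoid.mult = (+), one = 0\<rparr>"
  by (simp add: rat_group_def ring_of_type_algebra_def)

interpretation Q: rat_subring UNIV
  by unfold_locales auto

lemma Q_invertible_iff: "Q.invertible c \<longleftrightarrow> c \<noteq> 0"
  by (auto simp: Q.invertible_def intro: exI[of _ "1 / c"])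

lemma Q_ideal_index: "Q.ideal_index x = (if x = 0 then \<infinity> else 1)"
  by (simp add: Q.ideal_index_0 Q.ideal_index_invertible Q_invertible_iff)

lemma Q_spectrum:
  assumes "\<theta> \<in> hom integer_group (AutoGroup rat_group)"
  shows "\<theta> 1 1 \<noteq> 1 \<Longrightarrow> \<theta> 1 1 \<noteq> -1 \<Longrightarrow>
      reidemeister_spectrum (semidirect_product rat_group \<theta> integer_group) = {\<infinity>}"
    and "\<theta> 1 1 = 1 \<or> \<theta> 1 1 = -1 \<Longrightarrow>
      reidemeister_spectrum (semidirect_product rat_group \<theta> integer_group) = {2} \<union> {\<infinity>}"
proof -
  \<comment> \<open>The rationals are divisible by every positive integer; \<open>q = 2\<close> is
    an arbitrary choice.\<close>
  interpret rat_semidirect UNIV 2 \<theta>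
    using assms by unfold_locales (auto simp: rat_group_eq)
  show "reidemeister_spectrum (semidirect_product rat_group \<theta> integer_group) = {\<infinity>}"
    if "u \<noteq> 1" "u \<noteq> -1"
    using spectrum_trivial that square_eq_1_iff[of u] by (simp add: rat_group_eq)
  assume u: "u = 1 \<or> u = -1"
  define I where "I c = Q.ideal_index (1 - c) + Q.ideal_index (1 - u * c)" for c
  have "I c \<in> {2, \<infinity>}" for c
    by (simp add: I_def Q_ideal_index)
  then have "I ` {c. Q.invertible c} \<subseteq> {2, \<infinity>}"
    by (rule image_subsetI)
  \<comment> \<open>The unit \<open>2\<close> keeps \<open>1 - c\<close> and
    \<open>1 - u * c\<close> nonzero for both signs of \<open>u\<close>, so it attains the finite
    value.\<close>
  moreover have "I 2 \<in> I ` {c. Q.invertible c}"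
    by (rule imageI) (simp add: Q_invertible_iff)
  moreover have "I 2 = 2"
    using u by (auto simp: I_def Q_ideal_index)
  ultimately have "I ` {c. Q.invertible c} \<union> {\<infinity>} = {2} \<union> {\<infinity>}"
    by auto
  moreover have "u * u = 1"
    using u by (elim disjE) simp_all
  ultimately show "reidemeister_spectrum (semidirect_product rat_group \<theta> integer_group) = {2} \<union> {\<infinity>}"
    using spectrum_eq by (simp only: rat_group_eq I_def image_Collect)
qed

section \<open>The ring \<int>[1/p] and its units\<close>

text \<open>The fractions need not be reduced, so sums and products can be formed over the
  denominator \<open>p ^ (i + j)\<close>. For prime \<open>p\<close>,
  \<open>generate_ring_eq\<close> identifies the set with the generated ring.\<close>

definition Z_inv_set :: "nat \<Rightarrow> rat set" where
  "Z_inv_set p = {of_int k / of_nat p ^ j | k j. True}"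

lemma Z_inv_set_I: "of_int k / of_nat p ^ j \<in> Z_inv_set p"
  by (auto simp: Z_inv_set_def)

locale Z_inv =
  fixes p :: nat
  assumes prime_p: "prime p"
begin

abbreviation "P \<equiv> rat_of_nat p"

lemma p_gt_1: "p > 1"
  using prime_p by (rule prime_gt_1_nat)

lemma P_ne_0: "P \<noteq> 0"
  using p_gt_1 by simp

sublocale rat_subring "Z_inv_set p"
proof
  show "1 \<in> Z_inv_set p"
    using Z_inv_set_I[of 1 p 0] by simp
  fix a b assume "a \<in> Z_inv_set p" "b \<in> Z_inv_set p"
  then obtain k l i j where a: "a = of_int k / P ^ i" and b: "b = of_int l / P ^ j"
    by (auto simp: Z_inv_set_def)
  have "a + b = of_int (k * int p ^ j + l * int p ^ i) / P ^ (i + j)"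
    using P_ne_0 by (simp add: a b add_frac_eq power_add)
  then show "a + b \<in> Z_inv_set p"
    by (simp only: Z_inv_set_I)
  have "- a = of_int (- k) / P ^ i"
    by (simp add: a)
  then show "- a \<in> Z_inv_set p"
    by (simp only: Z_inv_set_I)
  have "a * b = of_int (k * l) / P ^ (i + j)"
    by (simp add: a b power_add)
  then show "a * b \<in> Z_inv_set p"
    by (simp only: Z_inv_set_I)
qed

lemma inverse_power_mem: "1 / P ^ k \<in> Z_inv_set p"
  using Z_inv_set_I[of 1 p k] by simp

lemma inverse_p_mem: "1 / P \<in> Z_inv_set p"
  using inverse_power_mem[of 1] by simp

text \<open>One inclusion is an induction over the generation. For the other, the generated ring is
  itself a \<open>rat_subring\<close>, so it contains all integers and all powers of
  \<open>1 / P\<close>.\<close>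

lemma generate_ring_eq: "generate_ring ring_of_type_algebra {1 / P} = Z_inv_set p"
proof
  let ?R = "ring_of_type_algebra :: rat ring"
  interpret R: ring ?R
    by (rule ring_from_type_algebra)
  have neg: "\<ominus>\<^bsub>?R\<^esub> x = - x" for x
    by (rule R.minus_equality) (auto simp: ring_of_type_algebra_def)
  have "x \<in> Z_inv_set p" if "x \<in> generate_ring ?R {1 / P}" for x
    using that
  proof induction
    case one
    then show ?case using one_mem by (simp add: ring_of_type_algebra_def)
  next
    case (incl h)
    then show ?case using inverse_p_mem by simp
  next
    case (a_inv h)
    then show ?case by (simp add: neg uminus_mem)
  next
    case (eng_add h1 h2)
    then show ?case using add_mem by (simp add: ring_of_type_algebra_def)
  next
    case (eng_mult h1 h2)
    then show ?case using mult_mem by (simp add: ring_of_type_algebra_def)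
  qed
  then show "generate_ring ?R {1 / P} \<subseteq> Z_inv_set p"
    by blast
  interpret gen: rat_subring "generate_ring ?R {1 / P}"
  proof
    show "1 \<in> generate_ring ?R {1 / P}"
      using generate_ring.one[of ?R] by (simp add: ring_of_type_algebra_def)
    fix a b assume "a \<in> generate_ring ?R {1 / P}" "b \<in> generate_ring ?R {1 / P}"
    then show "a + b \<in> generate_ring ?R {1 / P}" "- a \<in> generate_ring ?R {1 / P}"
        "a * b \<in> generate_ring ?R {1 / P}"
      using generate_ring.eng_add[of a ?R _ b] generate_ring.a_inv[of a ?R]
        generate_ring.eng_mult[of a ?R _ b] neg
      by (simp_all add: ring_of_type_algebra_def)
  qed
  have "of_int k / P ^ j \<in> generate_ring ?R {1 / P}" for k j
    using gen.mult_mem[OF gen.of_int_mem gen.power_mem[OF generate_ring.incl], of "1 / P" k j]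
    by (simp add: power_divide)
  then show "Z_inv_set p \<subseteq> generate_ring ?R {1 / P}"
    by (auto simp: Z_inv_set_def)
qed

lemma Z_inv_group_eq: "Z_inv_group p = \<lparr>carrier = Z_inv_set p, monoid.mult = (+), one = 0\<rparr>"
  using generate_ring_eq by (simp add: Z_inv_group_def Z_inv_ring_def ring_of_type_algebra_def)

text \<open>Clearing denominators in \<open>c * d = 1\<close> gives
  \<open>k * l = p ^ (i + j)\<close> in the integers, so the numerator of \<open>c\<close> is a
  power of \<open>p\<close> up to sign. Listing reciprocals separately keeps the exponents
  natural.\<close>

lemma invertible_iff:
  "invertible c \<longleftrightarrow> (\<exists>k. c \<in> {P ^ k, - (P ^ k), 1 / P ^ k, - (1 / P ^ k)})"
proof
  assume "invertible c"
  then obtain d where d: "c \<in> Z_inv_set p" "d \<in> Z_inv_set p" "c * d = 1"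
    unfolding invertible_def by blast
  then obtain k i l j where c: "c = of_int k / P ^ i" and "d = of_int l / P ^ j"
    unfolding Z_inv_set_def by blast
  then have "of_int k * of_int l = P ^ i * P ^ j"
    using d(3) P_ne_0 by (simp add: divide_eq_eq)
  then have "rat_of_int (k * l) = rat_of_int (int p ^ (i + j))"
    by (simp add: power_add)
  then have "k * l = int p ^ (i + j)"
    by (simp only: of_int_eq_iff)
  then have "nat \<bar>k\<bar> * nat \<bar>l\<bar> = p ^ (i + j)"
    by (metis abs_mult abs_of_nat nat_abs_mult_distrib nat_int of_nat_power)
  then have "nat \<bar>k\<bar> dvd p ^ (i + j)"
    by (metis dvd_triv_left)
  then obtain m where "nat \<bar>k\<bar> = p ^ m"
    using divides_primepow_nat[OF prime_p] by blast
  then have "\<bar>k\<bar> = int p ^ m"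
    by (metis abs_ge_zero int_nat_eq of_nat_power)
  then have "k = int p ^ m \<or> k = - (int p ^ m)"
    by linarith
  then have "c = P ^ m / P ^ i \<or> c = - (P ^ m / P ^ i)"
    unfolding c by auto
  moreover have "P ^ m / P ^ i = P ^ (m - i) \<or> P ^ m / P ^ i = 1 / P ^ (i - m)"
  proof (cases "i \<le> m")
    case True
    then show ?thesis using P_ne_0 by (simp add: power_diff)
  next
    case False
    then show ?thesis using P_ne_0 by (simp add: power_diff)
  qed
  ultimately show "\<exists>k. c \<in> {P ^ k, - (P ^ k), 1 / P ^ k, - (1 / P ^ k)}"
    by auto
next
  have *: "P ^ k \<in> Z_inv_set p" "P ^ k * (1 / P ^ k) = 1" for k
    using power_mem[OF of_nat_mem] P_ne_0 by simp_all
  have "invertible (P ^ k)" "invertible (1 / P ^ k)" for k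
    unfolding invertible_def using * inverse_power_mem[of k] by (metis mult.commute)+
  moreover have "invertible (- c)" if "invertible c" for c
    using that unfolding invertible_def by (metis minus_mult_minus uminus_mem)
  moreover assume "\<exists>k. c \<in> {P ^ k, - (P ^ k), 1 / P ^ k, - (1 / P ^ k)}"
  ultimately show "invertible c"
    by blast
qed

section \<open>Indices in \<int>[1/p]\<close>

text \<open>Because \<open>p\<close> is invertible modulo \<open>N\<close>, inverting
  \<open>p\<close> does not change the quotient by \<open>N\<close>: the numbers
  \<open>0, ..., N - 1\<close> still represent each coset exactly once.\<close>

lemma ideal_index_of_nat:
  assumes N: "N > 0" "coprime N p"
  shows "ideal_index (of_nat N) = enat N"
proof -
  let ?C = "ideal_coset (rat_of_nat N)"
  have inj: "inj_on (\<lambda>r. ?C (of_nat r)) {..<N}"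
  proof (rule inj_onI)
    fix r s assume rs: "r \<in> {..<N}" "s \<in> {..<N}" and "?C (of_nat r) = ?C (of_nat s)"
    then obtain k j where "rat_of_nat s - of_nat r = of_nat N * (of_int k / P ^ j)"
      using ideal_coset_eq_iff[OF of_nat_mem of_nat_mem] by (auto simp: Z_inv_set_def)
    then have "(rat_of_nat s - of_nat r) * P ^ j = of_nat N * of_int k"
      using P_ne_0 by (simp add: eq_divide_eq)
    then have "rat_of_int ((int s - int r) * int p ^ j) = rat_of_int (int N * k)"
      by simp
    then have "(int s - int r) * int p ^ j = int N * k"
      by (simp only: of_int_eq_iff)
    then have "int N dvd (int s - int r) * int p ^ j"
      by (rule dvdI)
    moreover have "coprime (int N) (int p ^ j)"
      using N(2) by simp
    ultimately have "int N dvd int s - int r"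
      using coprime_dvd_mult_left_iff by blast
    then show "r = s"
      using rs mod_eq_dvd_iff[of "int s" "int N" "int r"] by simp
  qed
  have "?C a \<in> (\<lambda>r. ?C (of_nat r)) ` {..<N}" if a: "a \<in> Z_inv_set p" for a
  proof -
    obtain k j where kj: "a = of_int k / P ^ j"
      using a unfolding Z_inv_set_def by blast
    have "coprime (int p ^ j) (int N)"
      using N(2) by (simp add: coprime_commute[of p])
    \<comment> \<open>\<open>x\<close> inverts \<open>p ^ j\<close> modulo \<open>N\<close>, so
      \<open>k / p ^ j\<close> is congruent to \<open>k * x\<close>, whose residue is the
      representative \<open>r\<close>.\<close>
    then obtain x y where xy: "x * int p ^ j + y * int N = 1"
      using bezout_int[of "int p ^ j" "int N"] unfolding coprime_iff_gcd_eq_1 by metis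
    define r where "r = nat ((k * x) mod int N)"
    have r: "int r = (k * x) mod int N" "r < N"
      using N(1) by (auto simp: r_def nat_less_iff)
    then obtain z where z: "k * x = int r + int N * z"
      by (metis mod_mult_div_eq)
    have "int r * int p ^ j - k = (k * x - int N * z) * int p ^ j - k * (x * int p ^ j + y * int N)"
      using z xy by simp
    also have "\<dots> = int N * (- z * int p ^ j - k * y)"
      by (simp add: algebra_simps)
    finally have "rat_of_int (int r * int p ^ j - k) = rat_of_int (int N * (- z * int p ^ j - k * y))"
      by simp
    moreover have "of_nat r - a = rat_of_int (int r * int p ^ j - k) / P ^ j"
      using P_ne_0 by (simp add: kj diff_divide_distrib)
    ultimately have "of_nat r - a = of_nat N * (of_int (- z * int p ^ j - k * y) / P ^ j)"
      by simp
    then have "?C a = ?C (of_nat r)"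
      unfolding ideal_coset_eq_iff[OF a of_nat_mem] using Z_inv_set_I by blast
    then show ?thesis
      using r(2) by blast
  qed
  then have "?C ` Z_inv_set p = (\<lambda>r. ?C (of_nat r)) ` {..<N}"
    using of_nat_mem by blast
  then show ?thesis
    using card_image[OF inj] by (simp add: ideal_index_def ecard_def)
qed

text \<open>At \<open>k = 0\<close> the generator \<open>1 - p ^ k\<close> is \<open>0\<close>, and
  the zero ideal has infinite index.\<close>

definition minus_index :: "nat \<Rightarrow> enat" where
  "minus_index k = (if k = 0 then \<infinity> else enat (p ^ k - 1))"

text \<open>The exception arises because \<open>1 + 2 ^ 0 = 2\<close> is a unit of \<int>[1/2]; in
  all other cases \<open>p ^ k + 1\<close> is prime to \<open>p\<close>.\<close>

definition plus_index :: "nat \<Rightarrow> enat" where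
  "plus_index k = (if k = 0 \<and> p = 2 then 1 else enat (p ^ k + 1))"

lemma coprime_power_p:
  assumes "k \<noteq> 0"
  shows "coprime (p ^ k - 1) p" "coprime (p ^ k + 1) p"
proof -
  have "coprime (p ^ k) (p ^ k - 1)" "coprime (p ^ k) (p ^ k + 1)"
    using coprime_diff_one_right_nat[of "p ^ k"] coprime_Suc_right_nat[of "p ^ k"] p_gt_1 by simp_all
  then have "coprime p (p ^ k - 1)" "coprime p (p ^ k + 1)"
    using assms by (simp_all only: coprime_power_left_iff simp_thms)
  then show "coprime (p ^ k - 1) p" "coprime (p ^ k + 1) p"
    by (simp_all only: coprime_commute[of p])
qed

lemma ideal_index_one_minus: "ideal_index (1 - P ^ k) = minus_index k"
proof (cases "k = 0")
  case False
  then have "p ^ k > 1"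
    using one_less_power[OF p_gt_1] by blast
  then have "ideal_index (rat_of_nat (p ^ k - 1)) = enat (p ^ k - 1)"
    using False coprime_power_p(1)[of k] by (intro ideal_index_of_nat) auto
  moreover have "1 - P ^ k = - 1 * rat_of_nat (p ^ k - 1)"
    using \<open>p ^ k > 1\<close> by (simp add: of_nat_diff)
  moreover have "invertible (- 1)"
    using invertible_iff[of "-1"] by (auto intro: exI[of _ 0])
  ultimately show ?thesis
    using False by (simp only: ideal_index_mult_invertible minus_index_def if_False)
qed (simp add: ideal_index_0 minus_index_def)

lemma ideal_index_one_plus: "ideal_index (1 + P ^ k) = plus_index k"
proof (cases "k = 0 \<and> p = 2")
  case True
  then have "invertible 2"
    using invertible_iff[of 2] by (auto intro: exI[of _ 1])
  moreover have "1 + P ^ k = 2"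
    using True by simp
  ultimately show ?thesis
    unfolding plus_index_def if_P[OF True] by (simp only: ideal_index_invertible)
next
  case False
  have "coprime (p ^ k + 1) p"
  proof (cases "k = 0")
    case True
    then have "odd p"
      using False prime_odd_nat[OF prime_p] p_gt_1 by simp
    then show ?thesis
      using True by (simp add: coprime_left_2_iff_odd numeral_2_eq_2[symmetric])
  qed (use coprime_power_p in auto)
  then have "ideal_index (rat_of_nat (p ^ k + 1)) = enat (p ^ k + 1)"
    by (intro ideal_index_of_nat) auto
  moreover have "rat_of_nat (p ^ k + 1) = 1 + P ^ k"
    by simp
  ultimately show ?thesis
    using False by (simp only: plus_index_def if_False)
qed

text \<open>Multiplying by the unit \<open>P ^ k\<close>, with a sign in the first case, leads back
  to positive exponents; so \<open>c\<close> and \<open>1 / c\<close> give the same indices.\<close>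

lemma ideal_index_inverse_power:
  "ideal_index (1 - 1 / P ^ k) = minus_index k" "ideal_index (1 + 1 / P ^ k) = plus_index k"
proof -
  have "1 - 1 / P ^ k = - (1 / P ^ k) * (1 - P ^ k)" "1 + 1 / P ^ k = (1 / P ^ k) * (1 + P ^ k)"
    using P_ne_0 by (simp_all add: field_simps)
  moreover have "invertible (- (1 / P ^ k))" "invertible (1 / P ^ k)"
    unfolding invertible_iff by auto
  ultimately show "ideal_index (1 - 1 / P ^ k) = minus_index k"
      "ideal_index (1 + 1 / P ^ k) = plus_index k"
    by (simp_all only: ideal_index_mult_invertible ideal_index_one_minus ideal_index_one_plus)
qed

section \<open>Spectra over \<int>[1/p]\<close>

text \<open>For \<open>u = 1\<close> the two summands of \<open>spectrum_eq\<close> coincide, and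
  the sign of \<open>c\<close> selects minus or plus. For \<open>u = -1\<close> one summand is of
  each kind, whatever the sign of \<open>c\<close>.\<close>

lemma Z_inv_spectrum:
  assumes "\<theta> \<in> hom integer_group (AutoGroup (Z_inv_group p))"
  defines "S \<equiv> reidemeister_spectrum (semidirect_product (Z_inv_group p) \<theta> integer_group)"
  shows "\<theta> 1 1 \<noteq> 1 \<Longrightarrow> \<theta> 1 1 \<noteq> -1 \<Longrightarrow> S = {\<infinity>}"
    and "\<theta> 1 1 = 1 \<Longrightarrow> S = range (\<lambda>k. 2 * minus_index k) \<union> range (\<lambda>k. 2 * plus_index k) \<union> {\<infinity>}"
    and "\<theta> 1 1 = -1 \<Longrightarrow> S = range (\<lambda>k. minus_index k + plus_index k) \<union> {\<infinity>}"
proof -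
  interpret rat_semidirect "Z_inv_set p" p \<theta>
    using assms(1) p_gt_1 inverse_p_mem by unfold_locales (auto simp: Z_inv_group_eq)
  show "S = {\<infinity>}" if "u \<noteq> 1" "u \<noteq> -1"
    using spectrum_trivial that square_eq_1_iff[of u] by (simp add: S_def Z_inv_group_eq)
  note index = ideal_index_one_minus ideal_index_one_plus ideal_index_inverse_power
  define I where "I c = ideal_index (1 - c) + ideal_index (1 - u * c)" for c
  have S: "S = (\<Union>k. {I (P ^ k), I (- (P ^ k)), I (1 / P ^ k), I (- (1 / P ^ k))}) \<union> {\<infinity>}"
    if "u * u = 1"
    unfolding S_def Z_inv_group_eq spectrum_eq[OF that] invertible_iff I_def by blast
  show "S = range (\<lambda>k. 2 * minus_index k) \<union> range (\<lambda>k. 2 * plus_index k) \<union> {\<infinity>}" if u: "u = 1"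
  proof -
    have "I (P ^ k) = 2 * minus_index k" "I (1 / P ^ k) = 2 * minus_index k"
        "I (- (P ^ k)) = 2 * plus_index k" "I (- (1 / P ^ k)) = 2 * plus_index k" for k
      by (simp_all add: I_def u index mult_2)
    moreover have "u * u = 1"
      by (simp add: u)
    ultimately show ?thesis
      using S by auto
  qed
  show "S = range (\<lambda>k. minus_index k + plus_index k) \<union> {\<infinity>}" if u: "u = -1"
  proof -
    have "I (P ^ k) = minus_index k + plus_index k" "I (1 / P ^ k) = minus_index k + plus_index k"
        "I (- (P ^ k)) = minus_index k + plus_index k"
        "I (- (1 / P ^ k)) = minus_index k + plus_index k" for k
      by (simp_all add: I_def u index add.commute)
    moreover have "u * u = 1"
      by (simp add: u)
    ultimately show ?thesis
      using S by auto
  qed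
qed

text \<open>The terms \<open>- 1\<close> and \<open>+ 1\<close> cancel. At \<open>k = 0\<close> the
  infinite summand absorbs the other, so the prime \<open>2\<close> causes no exception
  here.\<close>

lemma minus_plus_index: "minus_index k + plus_index k = (if k = 0 then \<infinity> else enat (2 * p ^ k))"
proof -
  have "p ^ k > 0"
    using p_gt_1 by simp
  then have "(p ^ k - 1) + (p ^ k + 1) = 2 * p ^ k"
    by linarith
  then show ?thesis
    by (simp add: minus_index_def plus_index_def del: add_Suc_right)
qed

lemma range_minus_plus_index:
  "range (\<lambda>k. minus_index k + plus_index k) = insert \<infinity> {enat (2 * p ^ l) | l. l \<ge> 1}"
  unfolding minus_plus_index range_Suc_eq[symmetric] by (subst range_nat_eq) simp

lemma range_double_minus_index:
  "range (\<lambda>k. 2 * minus_index k) = insert \<infinity> {enat (2 * (p ^ l - 1)) | l. l \<ge> 1}"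
  unfolding minus_index_def range_Suc_eq[symmetric] by (subst range_nat_eq) (simp add: mult_2)

text \<open>For \<open>p = 2\<close> the exponent \<open>0\<close> contributes
  \<open>2 * 1 = 2\<close> rather than \<open>2 * (2 ^ 0 + 1) = 4\<close>.\<close>

lemma range_double_plus_index:
  "range (\<lambda>k. 2 * plus_index k) =
    (if p = 2 then {enat (2 * (2 ^ l + 1)) | l. l \<ge> 1} \<union> {2} else {enat (2 * (p ^ l + 1)) | l. l \<ge> 0})"
proof (cases "p = 2")
  case True
  have "range (\<lambda>k. 2 * plus_index k) = insert 2 (range (\<lambda>k. enat (2 * (p ^ Suc k + 1))))"
    unfolding plus_index_def by (subst range_nat_eq) (simp add: mult_2 True)
  moreover have "range (\<lambda>k. enat (2 * (2 ^ Suc k + 1))) = {enat (2 * (2 ^ l + 1)) | l. l \<ge> 1}"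
    by (rule range_Suc_eq)
  ultimately show ?thesis
    using True by simp
next
  case False
  then show ?thesis
    by (auto simp: plus_index_def mult_2)
qed

end

theorem proposition3p1:
  shows
    "(\<forall>\<theta> \<in> hom integer_group (AutoGroup rat_group).
        (\<theta> 1 1 \<noteq> 1 \<and> \<theta> 1 1 \<noteq> -1 \<longrightarrow>
          reidemeister_spectrum (semidirect_product rat_group \<theta> integer_group) = {\<infinity>}) \<and>
        (\<theta> 1 1 = 1 \<or> \<theta> 1 1 = -1 \<longrightarrow>
          reidemeister_spectrum (semidirect_product rat_group \<theta> integer_group) = {2} \<union> {\<infinity>}))
     \<and>
     (\<forall>p::nat. prime p \<and> odd p \<longrightarrow>
        (\<forall>\<theta> \<in> hom integer_group (AutoGroup (Z_inv_group p)).
          (\<theta> 1 1 \<noteq> 1 \<and> \<theta> 1 1 \<noteq> -1 \<longrightarrow>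
            reidemeister_spectrum (semidirect_product (Z_inv_group p) \<theta> integer_group) = {\<infinity>}) \<and>
          (\<theta> 1 1 = 1 \<longrightarrow>
            reidemeister_spectrum (semidirect_product (Z_inv_group p) \<theta> integer_group) =
              {enat (2 * (p ^ l + 1)) | l. l \<ge> 0} \<union> {enat (2 * (p ^ (l + 1) - 1)) | l. l \<ge> 0} \<union> {\<infinity>}) \<and>
          (\<theta> 1 1 = -1 \<longrightarrow>
            reidemeister_spectrum (semidirect_product (Z_inv_group p) \<theta> integer_group) =
              {enat (2 * p ^ (l + 1)) | l. l \<ge> 0} \<union> {\<infinity>})))
     \<and>
     (\<forall>\<theta> \<in> hom integer_group (AutoGroup (Z_inv_group 2)).
        (\<theta> 1 1 \<noteq> 1 \<and> \<theta> 1 1 \<noteq> -1 \<longrightarrow>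
          reidemeister_spectrum (semidirect_product (Z_inv_group 2) \<theta> integer_group) = {\<infinity>}) \<and>
        (\<theta> 1 1 = 1 \<longrightarrow>
          reidemeister_spectrum (semidirect_product (Z_inv_group 2) \<theta> integer_group) =
            {enat (2 * (2 ^ l + 1)) | l. l \<ge> 1} \<union> {enat (2 * (2 ^ l - 1)) | l. l \<ge> 1} \<union> {\<infinity>}) \<and>
        (\<theta> 1 1 = -1 \<longrightarrow>
          reidemeister_spectrum (semidirect_product (Z_inv_group 2) \<theta> integer_group) =
            {enat (2 ^ (l + 1)) | l. l \<ge> 1} \<union> {\<infinity>}))"
proof (intro conjI ballI allI impI; (elim conjE)?)
  fix \<theta> assume "\<theta> \<in> hom integer_group (AutoGroup rat_group)"
  note spec = Q_spectrum[OF this]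
  show "reidemeister_spectrum (semidirect_product rat_group \<theta> integer_group) = {\<infinity>}"
    if "\<theta> 1 1 \<noteq> 1" "\<theta> 1 1 \<noteq> -1"
    using spec(1) that .
  show "reidemeister_spectrum (semidirect_product rat_group \<theta> integer_group) = {2} \<union> {\<infinity>}"
    if "\<theta> 1 1 = 1 \<or> \<theta> 1 1 = -1"
    using spec(2) that .
next
  fix p :: nat and \<theta> assume "prime p" "odd p"
  then interpret Z_inv p
    by unfold_locales
  have "p \<noteq> 2"
    using \<open>odd p\<close> by auto
  assume "\<theta> \<in> hom integer_group (AutoGroup (Z_inv_group p))"
  note spec = Z_inv_spectrum[OF this]
  let ?S = "reidemeister_spectrum (semidirect_product (Z_inv_group p) \<theta> integer_group)"
  show "?S = {\<infinity>}" if "\<theta> 1 1 \<noteq> 1" "\<theta> 1 1 \<noteq> -1"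
    using spec(1) that .
  show "?S = {enat (2 * (p ^ l + 1)) | l. l \<ge> 0} \<union> {enat (2 * (p ^ (l + 1) - 1)) | l. l \<ge> 0} \<union> {\<infinity>}"
    if "\<theta> 1 1 = 1"
    unfolding spec(2)[OF that] range_double_minus_index range_double_plus_index if_not_P[OF \<open>p \<noteq> 2\<close>]
      shift_index[of "\<lambda>l. enat (2 * (p ^ l - 1))"]
    by blast
  show "?S = {enat (2 * p ^ (l + 1)) | l. l \<ge> 0} \<union> {\<infinity>}" if "\<theta> 1 1 = -1"
    unfolding spec(3)[OF that] range_minus_plus_index shift_index[of "\<lambda>l. enat (2 * p ^ l)"]
    by blast
next
  interpret Z_inv 2
    by unfold_locales (rule two_is_prime_nat)
  fix \<theta> assume "\<theta> \<in> hom integer_group (AutoGroup (Z_inv_group 2))"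
  note spec = Z_inv_spectrum[OF this]
  let ?S = "reidemeister_spectrum (semidirect_product (Z_inv_group 2) \<theta> integer_group)"
  show "?S = {\<infinity>}" if "\<theta> 1 1 \<noteq> 1" "\<theta> 1 1 \<noteq> -1"
    using spec(1) that .
  \<comment> \<open>The isolated value \<open>2\<close>, coming from \<open>c = -1\<close>, already
    occurs in the other family at \<open>l = 1\<close>.\<close>
  have "enat (2 * (2 ^ 1 - 1)) \<in> {enat (2 * (2 ^ l - 1)) | l. l \<ge> 1}"
    by blast
  moreover have "enat (2 * (2 ^ 1 - 1)) = 2"
    by (simp add: numeral_eq_enat)
  ultimately have "2 \<in> {enat (2 * (2 ^ l - 1)) | l. l \<ge> 1}"
    by metis
  then show "?S = {enat (2 * (2 ^ l + 1)) | l. l \<ge> 1} \<union> {enat (2 * (2 ^ l - 1)) | l. l \<ge> 1} \<union> {\<infinity>}"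
    if "\<theta> 1 1 = 1"
    unfolding spec(2)[OF that] range_double_minus_index range_double_plus_index if_P[OF refl]
    by blast
  show "?S = {enat (2 ^ (l + 1)) | l. l \<ge> 1} \<union> {\<infinity>}" if "\<theta> 1 1 = -1"
    unfolding spec(3)[OF that] range_minus_plus_index by simp
qed

end
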